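(* Let $H_0,H_1,H_2$ be Hilbert spaces and let $A_0:D(A_0)\subset H_0\to H_1$ and $A_1:D(A_1)\subset H_1\to H_2$ be (possibly unbounded) densely defined and closed linear operators with Hilbert space adjoints $A_0^*:D(A_0^* )\subset H_1\to H_0$ and $A_1^*:D(A_1^* )\subset H_2\to H_1$, satisfying the complex property $R(A_0)\subset N(A_1)$. Let the embedding $D(A_1)\cap D(A_0^* )\hookrightarrow H_1$ be compact. If $(x_n)\subset D(A_1)$ is a sequence bounded in $D(A_1)$ and $(y_n)\subset D(A_0^* )$ is a sequence bounded in $D(A_0^* )$, then there exist $x\in D(A_1)$ and $y\in D(A_0^* )$ as well as subsequences, again denoted by $(x_n)$ and $(y_n)$, such that $x_n\rightharpoonup x$ weakly in $D(A_1)$, $y_n\rightharpoonup y$ weakly in $D(A_0^* )$, and $$\langle x_n,y_n\rangle_{H_1}\to\langle x,y\rangle_{H_1}.$$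
   Context: $R(\cdot)$ and $N(\cdot)$ denote range and kernel. Domains of closed operators are Hilbert spaces with the graph norm; $D(A_1)\cap D(A_0^* )$ carries the norm $(|x|_{H_1}^2+|A_1x|_{H_2}^2+|A_0^*x|_{H_0}^2)^{1/2}$. *)

theory Defs
  imports "HOL-Analysis.Analysis"
begin

text \<open>The scalar field is either the reals or the complex numbers; the last axiom of the class
  leaves no other possibility. Both are instances.\<close>

class real_or_complex = real_normed_field +
  fixes conjugate :: "'a \<Rightarrow> 'a"
  assumes conjugate_add: "conjugate (a + b) = conjugate a + conjugate b"
    and conjugate_mult: "conjugate (a * b) = conjugate a * conjugate b"
    and mult_conjugate: "a * conjugate a = (norm a)\<^sup>2 *\<^sub>R 1"
    and real_or_complex:
      "(\<forall>z. \<exists>s. z = s *\<^sub>R 1) \<or>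
       (\<exists>i. i * i = - 1 \<and> (\<forall>z. \<exists>s t. z = s *\<^sub>R 1 + t *\<^sub>R i))"

instantiation real :: real_or_complex
begin
definition conjugate_real :: "real \<Rightarrow> real" where "conjugate_real a = a"
instance by standard (auto simp: conjugate_real_def power2_eq_square)
end

instantiation complex :: real_or_complex
begin
definition conjugate_complex :: "complex \<Rightarrow> complex" where "conjugate_complex a = cnj a"
instance
proof
  fix a b :: complex
  show "conjugate (a + b) = conjugate a + conjugate b"
    and "conjugate (a * b) = conjugate a * conjugate b"
    by (simp_all add: conjugate_complex_def)
  show "a * conjugate a = (norm a)\<^sup>2 *\<^sub>R 1"
    by (simp add: conjugate_complex_def complex_norm_square scaleR_conv_of_real del: of_real_power)
  have "\<i> * \<i> = (- 1 :: complex) \<and> (\<forall>z. \<exists>s t. z = s *\<^sub>R 1 + t *\<^sub>R \<i>)"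
    by (auto simp: complex_eq_iff)
  then show "(\<forall>z::complex. \<exists>s. z = s *\<^sub>R 1) \<or>
    (\<exists>i::complex. i * i = - 1 \<and> (\<forall>z. \<exists>s t. z = s *\<^sub>R 1 + t *\<^sub>R i))"
    by blast
qed
end

text \<open>A Hilbert space over such a field is a Banach space whose norm is induced by an inner
  product with values in that field. The inner product is linear in the first argument.\<close>

locale hilbert_space = vector_space scale
  for scale :: "'k::real_or_complex \<Rightarrow> 'a::banach \<Rightarrow> 'a" +
  fixes ip :: "'a \<Rightarrow> 'a \<Rightarrow> 'k"
  assumes scale_of_real: "scale (of_real r) x = r *\<^sub>R x"
    and ip_add_left: "ip (x + y) z = ip x z + ip y z"
    and ip_scale_left: "ip (scale c x) y = c * ip x y"
    and ip_conjugate: "ip y x = conjugate (ip x y)"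
    and ip_self: "ip x x = of_real ((norm x)\<^sup>2)"

lemma hilbert_space_real:
  "hilbert_space scaleR (inner :: 'a::{real_inner,banach} \<Rightarrow> 'a \<Rightarrow> real)"
  by unfold_locales
    (auto simp: conjugate_real_def algebra_simps inner_commute power2_norm_eq_inner)

lemma hilbert_space_complex:
  "hilbert_space (*) (\<lambda>x y :: complex. x * cnj y)"
  by unfold_locales
    (auto simp: conjugate_complex_def algebra_simps complex_norm_square scaleR_conv_of_real
      simp del: of_real_power)

text \<open>An unbounded operator is given by its domain \<open>D\<close> and a function \<open>A\<close>, whose values outside
  \<open>D\<close> are irrelevant.\<close>

definition linear_on ::
  "'a set \<Rightarrow> ('k \<Rightarrow> 'a::ab_group_add \<Rightarrow> 'a) \<Rightarrow> ('k \<Rightarrow> 'b::ab_group_add \<Rightarrow> 'b) \<Rightarrow> ('a \<Rightarrow> 'b) \<Rightarrow> bool"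
  where "linear_on D sa sb f \<longleftrightarrow>
    (\<forall>x\<in>D. \<forall>y\<in>D. f (x + y) = f x + f y) \<and> (\<forall>c. \<forall>x\<in>D. f (sa c x) = sb c (f x))"

definition linear_operator ::
  "('k::field \<Rightarrow> 'a::ab_group_add \<Rightarrow> 'a) \<Rightarrow> ('k \<Rightarrow> 'b::ab_group_add \<Rightarrow> 'b) \<Rightarrow> 'a set \<Rightarrow> ('a \<Rightarrow> 'b) \<Rightarrow> bool"
  where "linear_operator sa sb D A \<longleftrightarrow> module.subspace sa D \<and> linear_on D sa sb A"

definition densely_defined :: "'a::topological_space set \<Rightarrow> bool"
  where "densely_defined D \<longleftrightarrow> closure D = UNIV"

definition closed_operator ::
  "'a::topological_space set \<Rightarrow> ('a \<Rightarrow> 'b::topological_space) \<Rightarrow> bool"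
  where "closed_operator D A \<longleftrightarrow> closed ((\<lambda>x. (x, A x)) ` D)"

definition range_op :: "'a set \<Rightarrow> ('a \<Rightarrow> 'b) \<Rightarrow> 'b set"
  where "range_op D A = A ` D"

definition kernel_op :: "'a set \<Rightarrow> ('a \<Rightarrow> 'b::zero) \<Rightarrow> 'a set"
  where "kernel_op D A = {x \<in> D. A x = 0}"

definition adjoint_dom ::
  "('a \<Rightarrow> 'a \<Rightarrow> 'k) \<Rightarrow> ('b \<Rightarrow> 'b \<Rightarrow> 'k) \<Rightarrow> 'a set \<Rightarrow> ('a \<Rightarrow> 'b) \<Rightarrow> 'b set"
  where "adjoint_dom ipa ipb D A = {y. \<exists>z. \<forall>x\<in>D. ipb (A x) y = ipa x z}"

text \<open>On the domain of the adjoint, the element \<open>z\<close> is unique because \<open>D\<close> is dense.\<close>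

definition adjoint_op ::
  "('a \<Rightarrow> 'a \<Rightarrow> 'k) \<Rightarrow> ('b \<Rightarrow> 'b \<Rightarrow> 'k) \<Rightarrow> 'a set \<Rightarrow> ('a \<Rightarrow> 'b) \<Rightarrow> 'b \<Rightarrow> 'a"
  where "adjoint_op ipa ipb D A y = (THE z. \<forall>x\<in>D. ipb (A x) y = ipa x z)"

definition graph_norm :: "('a::real_normed_vector \<Rightarrow> 'b::real_normed_vector) \<Rightarrow> 'a \<Rightarrow> real"
  where "graph_norm A x = sqrt ((norm x)\<^sup>2 + (norm (A x))\<^sup>2)"

definition graph_norm2 ::
  "('a::real_normed_vector \<Rightarrow> 'b::real_normed_vector) \<Rightarrow> ('a \<Rightarrow> 'c::real_normed_vector) \<Rightarrow> 'a \<Rightarrow> real"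
  where "graph_norm2 A B x = sqrt ((norm x)\<^sup>2 + (norm (A x))\<^sup>2 + (norm (B x))\<^sup>2)"

text \<open>In what follows, \<open>V\<close> is a linear subspace of the type \<open>'a\<close> carrying its own norm \<open>N\<close>.\<close>

definition norm_bounded :: "('a \<Rightarrow> real) \<Rightarrow> 'a set \<Rightarrow> bool"
  where "norm_bounded N S \<longleftrightarrow> (\<exists>C. \<forall>x\<in>S. N x \<le> C)"

definition compact_embedding :: "'a::topological_space set \<Rightarrow> ('a \<Rightarrow> real) \<Rightarrow> bool"
  where "compact_embedding V N \<longleftrightarrow> (\<forall>S\<subseteq>V. norm_bounded N S \<longrightarrow> compact (closure S))"

definition bounded_functional ::
  "('k::real_normed_field \<Rightarrow> 'a::ab_group_add \<Rightarrow> 'a) \<Rightarrow> 'a set \<Rightarrow> ('a \<Rightarrow> real) \<Rightarrow> ('a \<Rightarrow> 'k) \<Rightarrow> bool"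
  where "bounded_functional sc V N \<phi> \<longleftrightarrow>
    linear_on V sc (*) \<phi> \<and> (\<exists>C. \<forall>v\<in>V. norm (\<phi> v) \<le> C * N v)"

definition weakly_converges ::
  "('k::real_normed_field \<Rightarrow> 'a::ab_group_add \<Rightarrow> 'a) \<Rightarrow> 'a set \<Rightarrow> ('a \<Rightarrow> real) \<Rightarrow> (nat \<Rightarrow> 'a) \<Rightarrow> 'a \<Rightarrow> bool"
  where "weakly_converges sc V N u x \<longleftrightarrow>
    (\<forall>n. u n \<in> V) \<and> x \<in> V \<and>
    (\<forall>\<phi>. bounded_functional sc V N \<phi> \<longrightarrow> (\<lambda>n. \<phi> (u n)) \<longlonglongrightarrow> \<phi> x)"

end

theory Submission
  imports Defs "HOL-Library.Diagonal_Subsequence"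
begin

text \<open>Let \<open>P\<close> be the orthogonal projection of \<open>H\<^sub>1\<close> onto \<open>R\<close>, the closure of \<open>R(A\<^sub>0)\<close>. Since
  \<open>R \<subseteq> N(A\<^sub>1)\<close> and the orthogonal complement of \<open>R\<close> lies in \<open>N(A\<^sub>0\<^sup>*)\<close>, both \<open>q\<^sub>n = x\<^sub>n - P x\<^sub>n\<close> and
  \<open>u\<^sub>n = P y\<^sub>n\<close> are bounded in \<open>D(A\<^sub>1) \<inter> D(A\<^sub>0\<^sup>*)\<close>, because \<open>A\<^sub>1 q\<^sub>n = A\<^sub>1 x\<^sub>n\<close> and \<open>A\<^sub>0\<^sup>* u\<^sub>n = A\<^sub>0\<^sup>* y\<^sub>n\<close>.
  Hence they converge strongly along a subsequence. By orthogonality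
  \<open>\<langle>x\<^sub>n, y\<^sub>n\<rangle> = \<langle>x\<^sub>n, u\<^sub>n\<rangle> + \<langle>q\<^sub>n, y\<^sub>n\<rangle>\<close>, and in each summand one factor converges weakly and the other
  strongly.\<close>

section \<open>The scalar field\<close>

lemma conjugate_0 [simp]: "conjugate (0::'k::real_or_complex) = 0"
  using conjugate_add[of "0::'k" 0] by simp

lemma conjugate_of_real [simp]: "conjugate (of_real r :: 'k::real_or_complex) = of_real r"
proof (cases "r = 0")
  case False
  have "of_real r * conjugate (of_real r :: 'k) = of_real r * of_real r"
    by (simp only: mult_conjugate) (simp add: scaleR_conv_of_real power2_eq_square flip: of_real_mult)
  then show ?thesis using False by simp
qed simp

lemma norm_conjugate [simp]: "norm (conjugate (a::'k::real_or_complex)) = norm a"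
proof (cases "a = 0")
  case False
  have "norm a * norm (conjugate a) = norm a * norm a"
    using arg_cong[OF mult_conjugate[of a], of norm] by (simp add: norm_mult power2_eq_square)
  then show ?thesis using False by simp
qed simp

text \<open>Both \<open>a * conjugate a\<close> and
  \<open>conjugate a * conjugate (conjugate a)\<close> equal the same squared norm, so the nonzero
  factor \<open>conjugate a\<close> cancels.\<close>

lemma conjugate_conjugate [simp]: "conjugate (conjugate (a::'k::real_or_complex)) = a"
proof (cases "a = 0")
  case False
  have "conjugate a * conjugate (conjugate a) = conjugate a * a"
    using mult_conjugate[of a] mult_conjugate[of "conjugate a"] by (simp add: mult.commute)
  moreover have "conjugate a \<noteq> 0"
    using False norm_conjugate[of a] by fastforce
  ultimately show ?thesis by simp
qed simp

lemma bounded_linear_conjugate: "bounded_linear (conjugate :: 'k::real_or_complex \<Rightarrow> 'k)"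
  by (rule bounded_linear_intro[where K = 1])
    (auto simp: conjugate_add conjugate_mult scaleR_conv_of_real)

text \<open>Heine-Borel for the scalars. The last class axiom gives one or two real coordinates, so
  the ball is a closed subset of a continuous image of an interval or a square.\<close>

lemma compact_cball_scalar: "compact (cball (0::'k::real_or_complex) B)"
proof -
  have "\<exists>K. compact K \<and> cball (0::'k) B \<subseteq> K"
    using real_or_complex[where 'a = 'k]
  proof
    assume *: "\<forall>z::'k. \<exists>s. z = s *\<^sub>R 1"
    have "cball (0::'k) B \<subseteq> (\<lambda>s. s *\<^sub>R 1) ` {-B..B}"
    proof
      fix z :: 'k assume "z \<in> cball 0 B"
      moreover obtain s where "z = s *\<^sub>R 1" using * by blast
      ultimately show "z \<in> (\<lambda>s. s *\<^sub>R 1) ` {-B..B}" by (auto simp: abs_le_iff)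
    qed
    moreover have "compact ((\<lambda>s. s *\<^sub>R (1::'k)) ` {-B..B})"
      by (intro compact_continuous_image continuous_intros) auto
    ultimately show ?thesis by blast
  next
    assume "\<exists>i::'k. i * i = - 1 \<and> (\<forall>z. \<exists>s t. z = s *\<^sub>R 1 + t *\<^sub>R i)"
    then obtain i :: 'k where i: "i * i = - 1" and rep: "\<And>z. \<exists>s t. z = s *\<^sub>R 1 + t *\<^sub>R i"
      by blast
    \<comment> \<open>The coordinates of a point of the ball must be bounded. From
      \<open>norm i = 1\<close> follows \<open>conjugate i = - i\<close>, and then
      \<open>mult_conjugate\<close> shows that the norm is Euclidean in \<open>s\<close> and
      \<open>t\<close>.\<close>
    have "norm i * norm i = 1"
      using arg_cong[OF i, of norm] by (simp add: norm_mult)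
    then have "norm i = 1"
      by (metis abs_norm_cancel real_sqrt_abs2 real_sqrt_one)
    then have "i * conjugate i = i * (- i)"
      using mult_conjugate[of i] i by simp
    moreover have "i \<noteq> 0" using i by auto
    ultimately have ci: "conjugate i = - i" using mult_left_cancel by blast
    have normz: "(norm (s *\<^sub>R 1 + t *\<^sub>R i))\<^sup>2 = s\<^sup>2 + t\<^sup>2" for s t
    proof -
      let ?z = "s *\<^sub>R 1 + t *\<^sub>R i"
      have "conjugate ?z = of_real s - of_real t * i"
        by (simp add: conjugate_add conjugate_mult scaleR_conv_of_real ci)
      then have "of_real ((norm ?z)\<^sup>2) = (of_real s + of_real t * i) * (of_real s - of_real t * i)"
        using mult_conjugate[of ?z] by (simp add: scaleR_conv_of_real)
      also have "\<dots> = of_real s * of_real s - of_real t * of_real t * (i * i)"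
        by (simp add: algebra_simps)
      also have "\<dots> = of_real (s\<^sup>2 + t\<^sup>2)"
        by (simp add: i power2_eq_square)
      finally show ?thesis using of_real_eq_iff by blast
    qed
    have "cball (0::'k) B \<subseteq> (\<lambda>p. fst p *\<^sub>R 1 + snd p *\<^sub>R i) ` ({-B..B} \<times> {-B..B})"
    proof
      fix z :: 'k assume z: "z \<in> cball 0 B"
      obtain s t where st: "z = s *\<^sub>R 1 + t *\<^sub>R i" using rep by blast
      have B: "B \<ge> 0" "(norm z)\<^sup>2 \<le> B\<^sup>2"
        using z norm_ge_zero[of z] by (auto intro: power_mono order_trans simp del: norm_ge_zero)
      then have "s\<^sup>2 \<le> B\<^sup>2" "t\<^sup>2 \<le> B\<^sup>2"
        using normz[of s t] zero_le_power2[of s] zero_le_power2[of t] unfolding st by linarith+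
      then have "\<bar>s\<bar> \<le> B" "\<bar>t\<bar> \<le> B"
        using B(1) by (metis abs_of_nonneg abs_le_square_iff)+
      then show "z \<in> (\<lambda>p. fst p *\<^sub>R 1 + snd p *\<^sub>R i) ` ({-B..B} \<times> {-B..B})"
        unfolding st by (intro image_eqI[where x = "(s, t)"]) auto
    qed
    moreover have "compact ((\<lambda>p. fst p *\<^sub>R 1 + snd p *\<^sub>R i) ` ({-B..B} \<times> {-B..B}))"
      by (intro compact_continuous_image continuous_intros compact_Times) auto
    ultimately show ?thesis by blast
  qed
  then obtain K where "compact K" "cball (0::'k) B \<subseteq> K" by blast
  then show ?thesis
    by (metis closed_cball compact_Int_closed inf.absorb_iff2)
qed

text \<open>Completeness comes from compactness: a Cauchy sequence is bounded, hence stays in a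
  compact ball.\<close>

lemma Cauchy_convergent_scalar:
  fixes f :: "nat \<Rightarrow> 'k::real_or_complex"
  assumes "Cauchy f"
  shows "convergent f"
proof -
  obtain B where "\<And>n. norm (f n) \<le> B"
    using cauchy_imp_bounded[OF assms] by (auto simp: bounded_iff)
  then have "\<forall>n. f n \<in> cball 0 B" by simp
  then show ?thesis
    using compact_imp_complete[OF compact_cball_scalar, of B] assms
    unfolding complete_def convergent_def by blast
qed

text \<open>Cantor's diagonal argument: Bolzano-Weierstrass handles each row \<open>m\<close> along
  any given subsequence, and the diagonal serves all rows at once.\<close>

lemma diagonal_subsequence_scalar:
  fixes f :: "nat \<Rightarrow> nat \<Rightarrow> 'k::real_or_complex"
  assumes bound: "\<And>m n. norm (f m n) \<le> B m"
  obtains r :: "nat \<Rightarrow> nat" where "strict_mono r" "\<And>m. convergent (\<lambda>n. f m (r n))"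
proof -
  interpret subseqs "\<lambda>m r. convergent (\<lambda>n. f m (r n))"
  proof
    fix m and s :: "nat \<Rightarrow> nat"
    have "\<forall>n. f m (s n) \<in> cball 0 (B m)" using bound by simp
    moreover have "seq_compact (cball (0::'k) (B m))"
      using compact_cball_scalar compact_eq_seq_compact_metric by blast
    ultimately obtain l r where "strict_mono r" "((\<lambda>n. f m (s n)) \<circ> r) \<longlonglongrightarrow> l"
      by (metis seq_compactE)
    then show "\<exists>r'. strict_mono r' \<and> convergent (\<lambda>n. f m ((s \<circ> r') n))"
      by (auto simp: convergent_def o_def)
  qed
  have "convergent (\<lambda>n. f m (diagseq n))" for m
  proof -
    \<comment> \<open>Only from index \<open>Suc m\<close> on is the diagonal known to refine the
      subsequence chosen for row \<open>m\<close>; the finitely many earlier terms do not affect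
      convergence.\<close>
    have "convergent (\<lambda>n. f m ((diagseq \<circ> ((+) (Suc m))) n))"
      by (rule diagseq_holds) (use convergent_subseq_convergent in \<open>force simp: o_def\<close>)
    then show ?thesis
      using convergent_ignore_initial_segment[of "\<lambda>n. f m (diagseq n)" "Suc m"] by (simp add: add.commute)
  qed
  then show thesis using that subseq_diagseq by blast
qed

section \<open>Hilbert spaces\<close>

context hilbert_space
begin

section \<open>Sesquilinearity, the Cauchy-Schwarz inequality and the parallelogram law\<close>

lemma scaleR_eq_scale: "r *\<^sub>R x = scale (of_real r) x"
  by (simp add: scale_of_real)

lemma ip_add_right: "ip x (y + z) = ip x y + ip x z"
  by (subst (1 2 3) ip_conjugate) (simp add: ip_add_left conjugate_add)

lemma ip_scale_right: "ip x (scale c y) = conjugate c * ip x y"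
  by (subst (1 2) ip_conjugate) (simp add: ip_scale_left conjugate_mult)

lemma ip_scaleR_left: "ip (r *\<^sub>R x) y = r *\<^sub>R ip x y"
  by (simp add: scaleR_eq_scale ip_scale_left scaleR_conv_of_real)

lemma ip_scaleR_right: "ip x (r *\<^sub>R y) = r *\<^sub>R ip x y"
  by (simp add: scaleR_eq_scale ip_scale_right scaleR_conv_of_real)

lemma ip_minus_left: "ip (- x) y = - ip x y"
  using ip_scaleR_left[of "-1" x y] by simp

lemma ip_minus_right: "ip x (- y) = - ip x y"
  using ip_scaleR_right[of x "-1" y] by simp

lemma ip_diff_left: "ip (x - y) z = ip x z - ip y z"
  using ip_add_left[of x "- y" z] by (simp add: ip_minus_left)

lemma ip_diff_right: "ip x (y - z) = ip x y - ip x z"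
  using ip_add_right[of x y "- z"] by (simp add: ip_minus_right)

lemma ip_zero_left [simp]: "ip 0 y = 0"
  using ip_diff_left[of 0 0 y] by simp

lemma ip_zero_right [simp]: "ip x 0 = 0"
  using ip_diff_right[of x 0 0] by simp

lemma ip_self_eq_0_iff: "ip x x = 0 \<longleftrightarrow> x = 0"
  by (simp add: ip_self)

lemma ip_eq_0_commute: "ip x y = 0 \<longleftrightarrow> ip y x = 0"
  by (metis ip_conjugate conjugate_0)

lemma norm_scale: "norm (scale c x) = norm c * norm x"
proof -
  have "of_real ((norm (scale c x))\<^sup>2) = c * conjugate c * ip x x"
    by (simp add: ip_scale_left ip_scale_right flip: ip_self del: of_real_power)
  also have "\<dots> = of_real ((norm c)\<^sup>2 * (norm x)\<^sup>2)"
    by (simp add: mult_conjugate ip_self scaleR_conv_of_real)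
  finally have "(norm (scale c x))\<^sup>2 = (norm c * norm x)\<^sup>2"
    unfolding of_real_eq_iff by (simp add: power_mult_distrib)
  then show ?thesis by simp
qed

text \<open>Pythagoras for the component of \<open>x\<close> orthogonal to \<open>z\<close>.
  Nonnegativity of the left side yields Cauchy-Schwarz; the exact decrease of the norm later shows
  that a nearest point is an orthogonal projection.\<close>

lemma norm_diff_projection_sq:
  assumes "z \<noteq> 0"
  shows "(norm (x - scale (ip x z / ip z z) z))\<^sup>2 = (norm x)\<^sup>2 - (norm (ip x z))\<^sup>2 / (norm z)\<^sup>2"
proof -
  let ?N = "of_real ((norm z)\<^sup>2) :: 'k" and ?a = "ip x z"
  let ?c = "?a / ?N"
  have N: "?N \<noteq> 0" using assms by simp
  have "conjugate ?c * ?N = conjugate (?c * ?N)"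
    by (simp only: conjugate_mult conjugate_of_real)
  then have cc: "conjugate ?c * ?N = conjugate ?a" using N by simp
  have "of_real ((norm (x - scale ?c z))\<^sup>2) = ip x x - conjugate ?c * ?a - ?c * (ip z x - conjugate ?c * ip z z)"
    by (simp only: ip_self[symmetric])
      (simp add: ip_diff_left ip_diff_right ip_scale_left ip_scale_right algebra_simps)
  also have "ip z x - conjugate ?c * ip z z = 0"
    using cc ip_conjugate[of z x] by (simp only: ip_self) simp
  also have "conjugate ?c * ?a = conjugate ?a * ?a / ?N"
    using cc N by (simp add: field_simps)
  also have "conjugate ?a * ?a = of_real ((norm ?a)\<^sup>2)"
    using mult_conjugate[of ?a] by (simp add: mult.commute scaleR_conv_of_real)
  also have "ip x x - of_real ((norm ?a)\<^sup>2) / ?N - ?c * 0 = of_real ((norm x)\<^sup>2 - (norm ?a)\<^sup>2 / (norm z)\<^sup>2)"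
    by (simp add: ip_self)
  finally show ?thesis unfolding of_real_eq_iff by (simp add: ip_self)
qed

lemma norm_ip_le: "norm (ip x y) \<le> norm x * norm y"
proof (cases "y = 0")
  case False
  have "0 \<le> (norm x)\<^sup>2 - (norm (ip x y))\<^sup>2 / (norm y)\<^sup>2"
    by (subst norm_diff_projection_sq[OF False, symmetric]) simp
  then have "(norm (ip x y))\<^sup>2 \<le> (norm x * norm y)\<^sup>2"
    using False by (simp add: field_simps power_mult_distrib)
  then show ?thesis by (rule power2_le_imp_le) simp
qed simp

lemma bounded_bilinear_ip: "bounded_bilinear ip"
  by unfold_locales
    (auto simp: ip_add_left ip_add_right ip_scaleR_left ip_scaleR_right
      intro!: exI[where x = 1] norm_ip_le)

lemmas tendsto_ip = bounded_bilinear.tendsto[OF bounded_bilinear_ip]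

lemma norm_add_sq_orthogonal:
  assumes "ip x y = 0"
  shows "(norm (x + y))\<^sup>2 = (norm x)\<^sup>2 + (norm y)\<^sup>2"
proof -
  have "ip (x + y) (x + y) = ip x x + ip y y"
    using assms ip_eq_0_commute[of x y] by (simp add: ip_add_left ip_add_right)
  then show ?thesis
    unfolding ip_self of_real_add[symmetric] of_real_eq_iff .
qed

lemma parallelogram_law:
  fixes x y :: 'a
  shows "(norm (x + y))\<^sup>2 + (norm (x - y))\<^sup>2 = 2 * (norm x)\<^sup>2 + 2 * (norm y)\<^sup>2"
proof -
  have "ip (x + y) (x + y) + ip (x - y) (x - y) = ip x x + ip x x + (ip y y + ip y y)"
    by (simp add: ip_add_left ip_add_right ip_diff_left ip_diff_right)
  then have "(norm (x + y))\<^sup>2 + (norm (x - y))\<^sup>2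
    = (norm x)\<^sup>2 + (norm x)\<^sup>2 + ((norm y)\<^sup>2 + (norm y)\<^sup>2)"
    unfolding ip_self of_real_add[symmetric] of_real_eq_iff .
  then show ?thesis by simp
qed

section \<open>Closed subspaces, orthogonal projection and Riesz representation\<close>

lemma subspace_scaleR: "subspace K \<Longrightarrow> x \<in> K \<Longrightarrow> r *\<^sub>R x \<in> K"
  by (simp add: scaleR_eq_scale subspace_scale)

lemma subspace_closure:
  assumes "subspace K"
  shows "subspace (closure K)"
proof (rule subspaceI)
  show "0 \<in> closure K"
    using subspace_0[OF assms] closure_subset by blast
  show "x + y \<in> closure K" if "x \<in> closure K" "y \<in> closure K" for x y
  proof -
    obtain f where "\<And>n. f n \<in> K" "f \<longlonglongrightarrow> x"
      using \<open>x \<in> closure K\<close> unfolding closure_sequential by blast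
    moreover obtain g where "\<And>n. g n \<in> K" "g \<longlonglongrightarrow> y"
      using \<open>y \<in> closure K\<close> unfolding closure_sequential by blast
    ultimately have "(\<forall>n. f n + g n \<in> K) \<and> (\<lambda>n. f n + g n) \<longlonglongrightarrow> x + y"
      by (simp add: tendsto_add subspace_add[OF assms])
    then show ?thesis
      unfolding closure_sequential by (rule exI[where x = "\<lambda>n. f n + g n"])
  qed
  show "scale c x \<in> closure K" if "x \<in> closure K" for c x
  proof -
    have "bounded_linear (scale c)"
      by (rule bounded_linear_intro[where K = "norm c"])
        (simp_all add: scale_right_distrib norm_scale scaleR_eq_scale mult.commute)
    then have "continuous_on (closure K) (scale c)"
      by (rule bounded_linear.continuous_on) (rule continuous_on_id)
    moreover have "scale c ` K \<subseteq> closure K"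
      using subspace_scale[OF assms] closure_subset by blast
    ultimately show ?thesis
      using image_closure_subset[of K "scale c" "closure K"] that by auto
  qed
qed

lemma ip_closure_eq_0:
  assumes "\<And>x. x \<in> K \<Longrightarrow> ip x y = 0" "x \<in> closure K"
  shows "ip x y = 0"
proof -
  obtain f where f: "\<And>n. f n \<in> K" "f \<longlonglongrightarrow> x"
    using assms(2) unfolding closure_sequential by blast
  have "(\<lambda>n. ip (f n) y) \<longlonglongrightarrow> ip x y"
    by (intro tendsto_ip f tendsto_const)
  then show ?thesis
    using assms(1) f(1) by (simp add: LIMSEQ_const_iff)
qed

text \<open>A sequence in \<open>K\<close> minimising the distance to \<open>x\<close> is Cauchy by
  the parallelogram law. Its limit is a nearest point, and minimality forces the residual to be
  orthogonal to \<open>K\<close>.\<close>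

lemma projection_exists:
  assumes K: "subspace K" "closed K"
  obtains p where "p \<in> K" "\<And>z. z \<in> K \<Longrightarrow> ip (x - p) z = 0"
proof -
  let ?d = "infdist x K"
  have ne: "K \<noteq> {}" using subspace_0[OF K(1)] by blast
  have dle: "?d\<^sup>2 \<le> (norm (x - v))\<^sup>2" if "v \<in> K" for v
    using infdist_le[OF that, of x] infdist_nonneg[of x K] by (simp add: dist_norm power_mono)
  \<comment> \<open>The slack \<open>inverse (Suc n)\<close> is put on the squared distance because
    the parallelogram law is about squares.\<close>
  have "\<exists>v\<in>K. (norm (x - v))\<^sup>2 < ?d\<^sup>2 + inverse (Suc n)" for n
  proof -
    have "?d < sqrt (?d\<^sup>2 + inverse (Suc n))"
      by (rule real_less_rsqrt) simp
    then obtain v where v: "v \<in> K" "dist x v < sqrt (?d\<^sup>2 + inverse (Suc n))"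
      using infdist_notempty[OF ne, of x] cInf_less_iff[of "dist x ` K"] ne
      by (auto simp: bdd_below_def intro: zero_le_dist)
    then have "(norm (x - v))\<^sup>2 < ?d\<^sup>2 + inverse (Suc n)"
      using sqrt_le_D[of "?d\<^sup>2 + inverse (Suc n)"  "norm (x - v)"] real_le_lsqrt
      by (metis dist_norm norm_ge_zero not_le real_le_rsqrt)
    with v(1) show ?thesis by blast
  qed
  then obtain v where v: "\<And>n. v n \<in> K" "\<And>n. (norm (x - v n))\<^sup>2 < ?d\<^sup>2 + inverse (Suc n)"
    by metis
  have diff: "(norm (v m - v n))\<^sup>2 \<le> 2 * inverse (Suc m) + 2 * inverse (Suc n)" for m n
  proof -
    \<comment> \<open>The midpoint lies in \<open>K\<close>, so its distance to \<open>x\<close> is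
      at least \<open>?d\<close>. This bounds the sum term of the parallelogram law for
      \<open>x - v m\<close> and \<open>x - v n\<close> from below, hence the difference term from
      above.\<close>
    let ?w = "(1/2) *\<^sub>R (v m + v n)"
    have "?w \<in> K"
      by (intro subspace_scaleR subspace_add K(1) v)
    then have "4 * ?d\<^sup>2 \<le> 4 * (norm (x - ?w))\<^sup>2"
      using dle by simp
    also have "\<dots> = (norm (2 *\<^sub>R (x - ?w)))\<^sup>2"
      by (simp add: power2_eq_square)
    also have "2 *\<^sub>R (x - ?w) = (x - v m) + (x - v n)"
      by (simp add: scaleR_2 algebra_simps)
    finally show ?thesis
      using parallelogram_law[of "x - v m" "x - v n"] v(2)[of m] v(2)[of n]
      by (simp add: norm_minus_commute)
  qed
  have "Cauchy v"
  proof (rule metric_CauchyI)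
    fix e :: real assume "0 < e"
    \<comment> \<open>The bound \<open>diff\<close> is at most \<open>4 * inverse (Suc N)\<close>
      for indices beyond \<open>N\<close>, whence the quarter.\<close>
    then obtain N where N: "inverse (real (Suc N)) < e\<^sup>2 / 4"
      using reals_Archimedean[of "e\<^sup>2 / 4"] by auto
    have "dist (v m) (v n) < e" if "m \<ge> N" "n \<ge> N" for m n
    proof -
      have "inverse (real (Suc m)) \<le> inverse (real (Suc N))" "inverse (real (Suc n)) \<le> inverse (real (Suc N))"
        using that by (auto intro!: le_imp_inverse_le)
      then have "(norm (v m - v n))\<^sup>2 < e\<^sup>2"
        using diff[of m n] N by linarith
      then show ?thesis
        using \<open>0 < e\<close> by (simp add: dist_norm power_less_imp_less_base)
    qed
    then show "\<exists>N. \<forall>m\<ge>N. \<forall>n\<ge>N. dist (v m) (v n) < e" by blast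
  qed
  then obtain p where p: "v \<longlonglongrightarrow> p"
    using Cauchy_convergent_iff convergent_def by blast
  have "p \<in> K"
    using closed_sequentially[OF K(2) _ p] v(1) by blast
  have "(norm (x - p))\<^sup>2 \<le> ?d\<^sup>2 + 0"
  proof (rule LIMSEQ_le)
    show "(\<lambda>n. (norm (x - v n))\<^sup>2) \<longlonglongrightarrow> (norm (x - p))\<^sup>2"
      by (intro tendsto_intros p)
    show "(\<lambda>n. ?d\<^sup>2 + inverse (real (Suc n))) \<longlonglongrightarrow> ?d\<^sup>2 + 0"
      by (intro tendsto_add tendsto_const LIMSEQ_inverse_real_of_nat)
  qed (use v(2) less_imp_le in blast)
  have "ip (x - p) z = 0" if z: "z \<in> K" for z
  proof (cases "z = 0")
    case False
    \<comment> \<open>Moving from \<open>p\<close> by the optimal multiple of \<open>z\<close>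
      lowers the squared distance by \<open>(norm (ip (x - p) z))^2 / (norm z)^2\<close>. As
      \<open>p\<close> is already nearest, this gain vanishes.\<close>
    let ?c = "ip (x - p) z / ip z z"
    have "p + scale ?c z \<in> K"
      by (intro subspace_add subspace_scale K(1) \<open>p \<in> K\<close> z)
    then have "(norm (x - p))\<^sup>2 \<le> (norm (x - p - scale ?c z))\<^sup>2"
      using dle[of "p + scale ?c z"] \<open>(norm (x - p))\<^sup>2 \<le> ?d\<^sup>2 + 0\<close> unfolding diff_diff_eq by linarith
    then have "(norm (ip (x - p) z))\<^sup>2 / (norm z)\<^sup>2 \<le> 0"
      unfolding norm_diff_projection_sq[OF False] by simp
    then show ?thesis
      using False by (simp add: divide_le_0_iff)
  qed simp
  then show thesis using that \<open>p \<in> K\<close> by blast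
qed

text \<open>A nonzero functional is determined by its closed kernel and one vector of
  \<open>V\<close> orthogonal to it. The version relative to a closed subspace is what graphs of
  operators require.\<close>

lemma riesz_representation:
  assumes V: "subspace V" "closed V" and \<phi>: "bounded_functional scale V norm \<phi>"
  obtains w where "w \<in> V" "\<And>v. v \<in> V \<Longrightarrow> \<phi> v = ip v w"
proof -
  have add: "\<phi> (x + y) = \<phi> x + \<phi> y" if "x \<in> V" "y \<in> V" for x y
    using \<phi> that by (auto simp: bounded_functional_def linear_on_def)
  have sc: "\<phi> (scale c x) = c * \<phi> x" if "x \<in> V" for c x
    using \<phi> that by (auto simp: bounded_functional_def linear_on_def)
  have diff: "\<phi> (x - y) = \<phi> x - \<phi> y" if "x \<in> V" "y \<in> V" for x y
    using add[OF subspace_diff[OF V(1) that] that(2)] by simp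
  obtain C where C: "\<And>v. v \<in> V \<Longrightarrow> norm (\<phi> v) \<le> C * norm v"
    using \<phi> by (auto simp: bounded_functional_def)
  define K where "K = {v \<in> V. \<phi> v = 0}"
  have K: "subspace K"
    using subspace_0[OF V(1)] sc[of 0 0] by (intro subspaceI) (auto simp: K_def add sc intro: subspace_add subspace_scale V(1))
  have "closed K"
    unfolding closed_sequential_limits
  proof (intro allI impI)
    fix f l assume fl: "(\<forall>n. f n \<in> K) \<and> f \<longlonglongrightarrow> l"
    then have l: "l \<in> V"
      using V(2) unfolding closed_sequential_limits K_def by blast
    have "norm (\<phi> l) \<le> C * norm (l - f n)" for n
      using C[of "l - f n"] fl l diff[of l "f n"] subspace_diff[OF V(1)] by (simp add: K_def)
    moreover have "(\<lambda>n. C * norm (l - f n)) \<longlonglongrightarrow> C * norm (l - l)"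
      using fl by (intro tendsto_intros) auto
    ultimately have "norm (\<phi> l) \<le> C * norm (l - l)"
      by (intro LIMSEQ_le_const) auto
    then show "l \<in> K" using l by (simp add: K_def)
  qed
  show thesis
  proof (cases "V \<subseteq> K")
    case True
    then show thesis using that[of 0] subspace_0[OF V(1)] by (auto simp: K_def)
  next
    case False
    then obtain v0 where v0: "v0 \<in> V" "\<phi> v0 \<noteq> 0" by (auto simp: K_def)
    obtain p where p: "p \<in> K" "\<And>z. z \<in> K \<Longrightarrow> ip (v0 - p) z = 0"
      using projection_exists[OF K \<open>closed K\<close>] by blast
    define e where "e = v0 - p"
    have e: "e \<in> V" "\<phi> e \<noteq> 0"
      using v0 p(1) diff by (auto simp: e_def K_def intro: subspace_diff V(1))
    then have "e \<noteq> 0"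
      using sc[of 0 0] subspace_0[OF V(1)] by auto
    \<comment> \<open>The factor is normalised so that \<open>ip e ?w\<close> equals the value of
      the functional at \<open>e\<close>; it is conjugated since \<open>ip\<close> is
      conjugate-linear in its second argument.\<close>
    let ?w = "scale (conjugate (\<phi> e / ip e e)) e"
    have "\<phi> v = ip v ?w" if v: "v \<in> V" for v
    proof -
      have "\<phi> (v - scale (\<phi> v / \<phi> e) e) = 0"
        using v e by (simp add: diff sc subspace_scale V(1))
      then have "v - scale (\<phi> v / \<phi> e) e \<in> K"
        using v e by (simp add: K_def subspace_diff subspace_scale V(1))
      then have "ip (v - scale (\<phi> v / \<phi> e) e) e = 0"
        using p(2) ip_eq_0_commute unfolding e_def by blast
      then show ?thesis
        using e \<open>e \<noteq> 0\<close> by (simp add: ip_diff_left ip_scale_left ip_scale_right ip_self_eq_0_iff)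
    qed
    moreover have "?w \<in> V" by (intro subspace_scale V(1) e)
    ultimately show thesis using that by blast
  qed
qed

text \<open>Separability is avoided by testing only against the terms \<open>u m\<close> themselves:
  a diagonal subsequence makes all these products converge, and projection onto the closed subspace
  of good test vectors extends this to every \<open>w\<close>. Riesz then turns the limit functional
  into a vector.\<close>

lemma weak_compactness_closed_subspace:
  assumes V: "subspace V" "closed V" and u: "\<And>n. u n \<in> V" "\<And>n. norm (u n) \<le> B"
  obtains r :: "nat \<Rightarrow> nat" and a where "strict_mono r" "weakly_converges scale V norm (u \<circ> r) a"
proof -
  have "norm (ip (u m) (u n)) \<le> norm (u m) * B" for m n
    by (rule order_trans[OF norm_ip_le]) (intro mult_left_mono u norm_ge_zero)
  then obtain r :: "nat \<Rightarrow> nat" where r: "strict_mono r"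
    and conv: "\<And>m. convergent (\<lambda>n. ip (u m) (u (r n)))"
    using diagonal_subsequence_scalar[of "\<lambda>m n. ip (u m) (u n)" "\<lambda>m. norm (u m) * B"] by blast
  define S where "S = {w. convergent (\<lambda>n. ip w (u (r n)))}"
  have "subspace S"
    by (rule subspaceI)
      (auto simp: S_def ip_add_left ip_scale_left intro: convergent_const convergent_add
        convergent_mult)
  have bd: "norm (ip w (u (r n))) \<le> norm w * B" for w n
    by (rule order_trans[OF norm_ip_le]) (intro mult_left_mono u norm_ge_zero)
  have "closed S"
    unfolding closed_sequential_limits
  proof (intro allI impI)
    fix f w assume fw: "(\<forall>n. f n \<in> S) \<and> f \<longlonglongrightarrow> w"
    have "Cauchy (\<lambda>n. ip w (u (r n)))"
    proof (rule metric_CauchyI)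
      fix e :: real assume "0 < e"
      \<comment> \<open>Since \<open>B\<close> bounds the sequence, replacing \<open>w\<close> by a
        close \<open>f k\<close> changes the products by less than \<open>e / 3\<close> for all
        indices at once. The remaining third is the Cauchy property for \<open>f k\<close>.\<close>
      have "(\<lambda>k. norm (w - f k) * B) \<longlonglongrightarrow> norm (w - w) * B"
        using fw by (intro tendsto_intros) auto
      then have "\<forall>\<^sub>F k in sequentially. norm (w - f k) * B < e / 3"
        using \<open>0 < e\<close> by (intro order_tendstoD(2)) auto
      then obtain k where k: "norm (w - f k) * B < e / 3"
        by (auto simp: eventually_sequentially)
      have "Cauchy (\<lambda>n. ip (f k) (u (r n)))"
        using fw by (auto simp: S_def intro: convergent_Cauchy)
      then obtain N where N: "\<And>m n. m \<ge> N \<Longrightarrow> n \<ge> N \<Longrightarrow> dist (ip (f k) (u (r m))) (ip (f k) (u (r n))) < e / 3"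
        using \<open>0 < e\<close> metric_CauchyD[of _ "e / 3"] by (metis divide_pos_pos zero_less_numeral)
      have near: "dist (ip w (u (r n))) (ip (f k) (u (r n))) < e / 3" for n
        using bd[of "w - f k" n] k by (simp add: dist_norm ip_diff_left)
      have "dist (ip w (u (r m))) (ip w (u (r n))) < e" if "m \<ge> N" "n \<ge> N" for m n
        using N[OF that] near[of m] near[of n] by metric
      then show "\<exists>N. \<forall>m\<ge>N. \<forall>n\<ge>N. dist (ip w (u (r m))) (ip w (u (r n))) < e" by blast
    qed
    then show "w \<in> S" by (simp add: S_def Cauchy_convergent_scalar)
  qed
  have uS: "u m \<in> S" for m using conv by (simp add: S_def)
  have all: "convergent (\<lambda>n. ip w (u (r n)))" for w
  proof -
    \<comment> \<open>The part of \<open>w\<close> orthogonal to \<open>S\<close> is orthogonal to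
      every \<open>u m\<close>, so only its projection \<open>p\<close> is seen by the
      sequence.\<close>
    obtain p where p: "p \<in> S" "\<And>z. z \<in> S \<Longrightarrow> ip (w - p) z = 0"
      using projection_exists[OF \<open>subspace S\<close> \<open>closed S\<close>] by blast
    have "ip w (u (r n)) = ip p (u (r n))" for n
      using p(2)[OF uS] by (simp add: ip_diff_left)
    then show ?thesis using p(1) by (simp add: S_def)
  qed
  define L where "L w = lim (\<lambda>n. ip w (u (r n)))" for w
  have L: "(\<lambda>n. ip w (u (r n))) \<longlonglongrightarrow> L w" for w
    using all by (simp add: L_def convergent_LIMSEQ_iff)
  have "bounded_functional scale UNIV norm L"
    unfolding bounded_functional_def linear_on_def
  proof (intro conjI ballI allI exI)
    show "L (x + y) = L x + L y" for x y
      using LIMSEQ_unique[OF L[of "x + y", unfolded ip_add_left] tendsto_add[OF L L]] .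
    show "L (scale c x) = c * L x" for c x
      using LIMSEQ_unique[OF L[of "scale c x", unfolded ip_scale_left] tendsto_mult_left[OF L]] .
    show "norm (L v) \<le> B * norm v" for v
      using bd[of v] by (intro LIMSEQ_le_const2[OF tendsto_norm[OF L]]) (auto simp: mult.commute)
  qed
  then obtain a where "a \<in> UNIV" and a_UNIV: "\<And>w. w \<in> UNIV \<Longrightarrow> L w = ip w a"
    by (rule riesz_representation[OF subspace_UNIV closed_UNIV]) (rule that)
  have a: "L w = ip w a" for w by (simp add: a_UNIV)
  \<comment> \<open>The weak limit stays in \<open>V\<close>: \<open>a - p\<close> is orthogonal to
    all terms of the sequence, so \<open>L (a - p) = 0\<close>, which makes \<open>a - p\<close>
    orthogonal to \<open>a\<close> as well as to \<open>p\<close>.\<close>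
  obtain p where p: "p \<in> V" "\<And>z. z \<in> V \<Longrightarrow> ip (a - p) z = 0"
    using projection_exists[OF V] by blast
  have "L (a - p) = 0"
    using LIMSEQ_unique[OF L[of "a - p"]] p(2) u(1) by simp
  then have "ip (a - p) (a - p) = 0"
    using p by (simp add: a ip_diff_right)
  then have "a \<in> V" using p(1) by (simp add: ip_self_eq_0_iff)
  have "(\<lambda>n. \<phi> ((u \<circ> r) n)) \<longlonglongrightarrow> \<phi> a" if \<phi>: "bounded_functional scale V norm \<phi>" for \<phi>
  proof -
    obtain w where w: "\<And>v. v \<in> V \<Longrightarrow> \<phi> v = ip v w"
      using riesz_representation[OF V \<phi>] by metis
    \<comment> \<open>\<open>L\<close> governs products with the sequence in the second slot,
      whereas Riesz puts it in the first; conjugation exchanges them.\<close>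
    have "(\<lambda>n. conjugate (ip w (u (r n)))) \<longlonglongrightarrow> conjugate (ip w a)"
      using L[of w] by (intro bounded_linear.tendsto[OF bounded_linear_conjugate]) (simp add: a)
    then show ?thesis
      using w u(1) \<open>a \<in> V\<close> by (simp flip: ip_conjugate)
  qed
  then have "weakly_converges scale V norm (u \<circ> r) a"
    using u(1) \<open>a \<in> V\<close> by (simp add: weakly_converges_def)
  then show thesis using that r by blast
qed

end

section \<open>Closed operators and their adjoints\<close>

text \<open>The norm of the product type is the Euclidean combination of the two norms, hence
  induced by the sum of the inner products. This is the ambient space for graphs.\<close>

lemma hilbert_space_prod:
  assumes "hilbert_space sa ipa" and "hilbert_space sb ipb"
  shows "hilbert_space (\<lambda>c p. (sa c (fst p), sb c (snd p)))
    (\<lambda>p q. ipa (fst p) (fst q) + ipb (snd p) (snd q))"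
proof -
  interpret a: hilbert_space sa ipa by fact
  interpret b: hilbert_space sb ipb by fact
  show ?thesis
  proof unfold_locales
    show "ipa (fst y) (fst x) + ipb (snd y) (snd x) = conjugate (ipa (fst x) (fst y) + ipb (snd x) (snd y))" for x y
      by (simp add: conjugate_add flip: a.ip_conjugate b.ip_conjugate)
    show "ipa (fst x) (fst x) + ipb (snd x) (snd x) = of_real ((norm x)\<^sup>2)" for x
      by (simp add: a.ip_self b.ip_self norm_prod_def)
  qed (auto simp: a.scale_left_distrib a.scale_right_distrib b.scale_left_distrib b.scale_right_distrib
      a.scale_of_real b.scale_of_real a.ip_add_left b.ip_add_left a.ip_scale_left b.ip_scale_left
      algebra_simps scaleR_prod_def)
qed

lemma weakly_converges_subseq:
  assumes "weakly_converges sc V N u x" and "strict_mono r"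
  shows "weakly_converges sc V N (u \<circ> r) x"
  using assms(1) LIMSEQ_subseq_LIMSEQ[OF _ assms(2)]
  unfolding weakly_converges_def by (fastforce simp: o_def)

text \<open>The graph of a closed operator is a closed subspace of the product Hilbert space, and its
  norm there is the graph norm.\<close>

lemma closed_operator_weak_compactness:
  assumes Ha: "hilbert_space sa ipa" and Hb: "hilbert_space sb ipb"
    and lin: "linear_operator sa sb D A" and closed: "closed_operator D A"
    and D: "range u \<subseteq> D" and bounded: "norm_bounded (graph_norm A) (range u)"
  obtains r :: "nat \<Rightarrow> nat" and x where "strict_mono r" "weakly_converges sa D (graph_norm A) (u \<circ> r) x"
proof -
  interpret a: hilbert_space sa ipa by fact
  interpret b: hilbert_space sb ipb by fact
  let ?s = "\<lambda>c p. (sa c (fst p), sb c (snd p))"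
  interpret p: hilbert_space ?s "\<lambda>p q. ipa (fst p) (fst q) + ipb (snd p) (snd q)"
    by (rule hilbert_space_prod) fact+
  let ?G = "(\<lambda>x. (x, A x)) ` D"
  have D_sub: "a.subspace D"
    and A_add: "\<And>x y. x \<in> D \<Longrightarrow> y \<in> D \<Longrightarrow> A (x + y) = A x + A y"
    and A_scale: "\<And>c x. x \<in> D \<Longrightarrow> A (sa c x) = sb c (A x)"
    using lin by (auto simp: linear_operator_def linear_on_def)
  have A0: "A 0 = 0"
    using A_scale[of 0 0] a.subspace_0[OF D_sub] by simp
  have G_sub: "p.subspace ?G"
  proof (rule p.subspaceI)
    show "0 \<in> ?G" using a.subspace_0[OF D_sub] A0 by (auto simp: zero_prod_def)
    show "v + w \<in> ?G" if "v \<in> ?G" "w \<in> ?G" for v w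
      using that a.subspace_add[OF D_sub] by (auto simp: image_iff A_add)
    show "?s c v \<in> ?G" if "v \<in> ?G" for c v
      using that a.subspace_scale[OF D_sub] by (auto simp: image_iff A_scale)
  qed
  have norm_pair: "norm (x, A x) = graph_norm A x" for x
    by (simp add: norm_prod_def graph_norm_def)
  obtain B where B: "\<And>n. norm (u n, A (u n)) \<le> B"
    using bounded by (auto simp: norm_bounded_def norm_pair)
  have uD: "u n \<in> D" for n using D by blast
  have uG: "(u n, A (u n)) \<in> ?G" for n using uD by blast
  obtain r :: "nat \<Rightarrow> nat" and w where r: "strict_mono r"
    and w: "weakly_converges ?s ?G norm ((\<lambda>n. (u n, A (u n))) \<circ> r) w"
    by (rule p.weak_compactness_closed_subspace[of ?G "\<lambda>n. (u n, A (u n))" B])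
      (use G_sub closed uG B in \<open>auto simp: closed_operator_def\<close>)
  obtain x where x: "x \<in> D" "w = (x, A x)"
    using w by (auto simp: weakly_converges_def)
  have "(\<lambda>n. \<phi> ((u \<circ> r) n)) \<longlonglongrightarrow> \<phi> x" if "bounded_functional sa D (graph_norm A) \<phi>" for \<phi>
  proof -
    \<comment> \<open>A graph-norm functional on \<open>D\<close> becomes a functional on the graph
      by composing with \<open>fst\<close>, so weak convergence in the graph descends to
      \<open>D\<close>.\<close>
    have "bounded_functional ?s ?G norm (\<phi> \<circ> fst)"
      using that by (auto simp: bounded_functional_def linear_on_def norm_pair)
    then show ?thesis
      using w x by (auto simp: weakly_converges_def o_def)
  qed
  then have "weakly_converges sa D (graph_norm A) (u \<circ> r) x"
    using uD x(1) by (auto simp: weakly_converges_def)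
  then show thesis using that r by blast
qed

section \<open>Weak convergence in the graph norm and products of weak and strong limits\<close>

lemma norm_le_graph_norm: "norm x \<le> graph_norm A x"
  unfolding graph_norm_def by (intro real_le_rsqrt) simp

text \<open>The graph norm dominates the ambient norm, so pairing with a fixed \<open>w\<close> is
  an admissible functional.\<close>

lemma weakly_converges_graph_ip:
  assumes "hilbert_space s ip" and "weakly_converges s D (graph_norm A) u x"
  shows "(\<lambda>n. ip (u n) w) \<longlonglongrightarrow> ip x w"
proof -
  interpret hilbert_space s ip by fact
  have "norm (ip v w) \<le> norm w * graph_norm A v" for v
    using norm_ip_le[of v w] mult_left_mono[OF norm_le_graph_norm[of v A], of "norm w"]
    by (simp add: mult.commute)
  then have "bounded_functional s D (graph_norm A) (\<lambda>v. ip v w)"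
    by (auto simp: bounded_functional_def linear_on_def ip_add_left ip_scale_left)
  then show ?thesis using assms(2) unfolding weakly_converges_def by blast
qed

text \<open>Split \<open>v n\<close> into \<open>y\<close> and \<open>v n - y\<close>: the first
  part is weak convergence, the second is at most \<open>B * norm (v n - y)\<close>.\<close>

lemma tendsto_ip_weak_strong:
  assumes H: "hilbert_space s ip" and u: "\<And>n. norm (u n) \<le> B"
    and weak: "\<And>w. (\<lambda>n. ip (u n) w) \<longlonglongrightarrow> ip x w" and strong: "v \<longlonglongrightarrow> y"
  shows "(\<lambda>n. ip (u n) (v n)) \<longlonglongrightarrow> ip x y"
proof -
  interpret hilbert_space s ip by fact
  have "(\<lambda>n. ip (u n) (v n - y)) \<longlonglongrightarrow> 0"
  proof (rule Lim_null_comparison)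
    show "\<forall>\<^sub>F n in sequentially. norm (ip (u n) (v n - y)) \<le> B * norm (v n - y)"
      by (intro always_eventually allI order_trans[OF norm_ip_le] mult_right_mono u norm_ge_zero)
    show "(\<lambda>n. B * norm (v n - y)) \<longlonglongrightarrow> 0"
      using tendsto_mult_left[OF tendsto_norm_zero[OF LIM_zero[OF strong]], of B] by simp
  qed
  then show ?thesis
    using tendsto_add[OF _ weak[of y]] by (fastforce simp: ip_diff_right)
qed

section \<open>The adjoint of a densely defined operator\<close>

context
  fixes sa :: "'k::real_or_complex \<Rightarrow> 'a::banach \<Rightarrow> 'a" and ipa
    and sb :: "'k \<Rightarrow> 'b::banach \<Rightarrow> 'b" and ipb
    and D :: "'a set" and A :: "'a \<Rightarrow> 'b"
  assumes Ha: "hilbert_space sa ipa" and Hb: "hilbert_space sb ipb"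
    and dense: "densely_defined D"
begin

interpretation a: hilbert_space sa ipa by (fact Ha)
interpretation b: hilbert_space sb ipb by (fact Hb)

text \<open>Two candidates for the adjoint value differ by a vector orthogonal to \<open>D\<close>,
  hence to its closure, which is the whole space and contains that difference. So the definite
  description is well defined.\<close>

lemma adjoint_eqI:
  assumes z: "\<And>x. x \<in> D \<Longrightarrow> ipb (A x) y = ipa x z"
  shows "y \<in> adjoint_dom ipa ipb D A" and "adjoint_op ipa ipb D A y = z"
proof -
  show "y \<in> adjoint_dom ipa ipb D A" using z by (auto simp: adjoint_dom_def)
  show "adjoint_op ipa ipb D A y = z"
    unfolding adjoint_op_def
  proof (rule the_equality)
    fix z' assume z': "\<forall>x\<in>D. ipb (A x) y = ipa x z'"
    have "ipa (z' - z) (z' - z) = 0"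
    proof (rule a.ip_closure_eq_0)
      show "ipa x (z' - z) = 0" if "x \<in> D" for x
        using z z' that by (simp add: a.ip_diff_right)
      show "z' - z \<in> closure D" using dense by (simp add: densely_defined_def)
    qed
    then show "z' = z" by (simp add: a.ip_self_eq_0_iff)
  qed (use z in blast)
qed

lemma adjoint_op:
  assumes "y \<in> adjoint_dom ipa ipb D A" "x \<in> D"
  shows "ipb (A x) y = ipa x (adjoint_op ipa ipb D A y)"
proof -
  obtain z where z: "\<And>x. x \<in> D \<Longrightarrow> ipb (A x) y = ipa x z"
    using assms(1) by (auto simp: adjoint_dom_def)
  then show ?thesis using adjoint_eqI(2)[of y z] assms(2) by simp
qed

lemma linear_operator_adjoint:
  "linear_operator sb sa (adjoint_dom ipa ipb D A) (adjoint_op ipa ipb D A)"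
proof -
  let ?D = "adjoint_dom ipa ipb D A" and ?A = "adjoint_op ipa ipb D A"
  have add: "y + z \<in> ?D \<and> ?A (y + z) = ?A y + ?A z" if "y \<in> ?D" "z \<in> ?D" for y z
    using adjoint_eqI[of "y + z" "?A y + ?A z"] adjoint_op that
    by (simp add: a.ip_add_right b.ip_add_right)
  have scale: "sb c y \<in> ?D \<and> ?A (sb c y) = sa c (?A y)" if "y \<in> ?D" for c y
    using adjoint_eqI[of "sb c y" "sa c (?A y)"] adjoint_op that
    by (simp add: a.ip_scale_right b.ip_scale_right)
  have "0 \<in> ?D" by (rule adjoint_eqI(1)[of 0 0]) simp
  then show ?thesis
    unfolding linear_operator_def linear_on_def using add scale by (simp add: b.subspaceI)
qed

text \<open>For each fixed \<open>x\<close> in \<open>D\<close> the defining identity is continuous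
  in the pair of \<open>y\<close> and its adjoint value, so it survives limits in the graph.\<close>

lemma closed_operator_adjoint:
  "closed_operator (adjoint_dom ipa ipb D A) (adjoint_op ipa ipb D A)"
  unfolding closed_operator_def closed_sequential_limits
proof (intro allI impI, elim conjE)
  let ?D = "adjoint_dom ipa ipb D A" and ?A = "adjoint_op ipa ipb D A"
  fix f l assume f: "\<forall>n. f n \<in> (\<lambda>y. (y, ?A y)) ` ?D" and l: "f \<longlonglongrightarrow> l"
  have fA: "fst (f n) \<in> ?D" "snd (f n) = ?A (fst (f n))" for n
    using spec[OF f, of n] by auto
  have "ipb (A x) (fst l) = ipa x (snd l)" if "x \<in> D" for x
  proof (rule LIMSEQ_unique)
    show "(\<lambda>n. ipb (A x) (fst (f n))) \<longlonglongrightarrow> ipb (A x) (fst l)"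
      by (intro b.tendsto_ip tendsto_fst tendsto_const l)
    have "(\<lambda>n. ipa x (snd (f n))) \<longlonglongrightarrow> ipa x (snd l)"
      by (intro a.tendsto_ip tendsto_snd tendsto_const l)
    then show "(\<lambda>n. ipb (A x) (fst (f n))) \<longlonglongrightarrow> ipa x (snd l)"
      by (simp add: adjoint_op[OF fA(1) that] fA(2))
  qed
  from adjoint_eqI[OF this] show "l \<in> (\<lambda>y. (y, ?A y)) ` ?D"
    by (intro image_eqI[where x = "fst l"]) simp_all
qed

end

text \<open>The kernel is the slice of the closed graph at second component 0.\<close>

lemma closed_kernel_op:
  fixes A :: "'a::real_normed_vector \<Rightarrow> 'b::real_normed_vector"
  assumes "closed_operator D A"
  shows "closed (kernel_op D A)"
  unfolding closed_sequential_limits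
proof (intro allI impI, elim conjE)
  fix f l assume f: "\<forall>n. f n \<in> kernel_op D A" and l: "f \<longlonglongrightarrow> l"
  have "(\<lambda>n. (f n, 0)) \<longlonglongrightarrow> (l, 0)" by (intro tendsto_Pair l tendsto_const)
  moreover have "(f n, 0) \<in> (\<lambda>x. (x, A x)) ` D" for n
    using f by (force simp: kernel_op_def)
  ultimately have "(l, 0) \<in> (\<lambda>x. (x, A x)) ` D"
    using closed_sequentially[OF assms[unfolded closed_operator_def], of "\<lambda>n. (f n, 0)"] by simp
  then show "l \<in> kernel_op D A" by (auto simp: kernel_op_def)
qed

lemma compact_embedding_subsequence:
  fixes u :: "nat \<Rightarrow> 'a::metric_space"
  assumes "compact_embedding V N" and "\<And>n. u n \<in> V" and "\<And>n. N (u n) \<le> C"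
  obtains r :: "nat \<Rightarrow> nat" and x where "strict_mono r" "(u \<circ> r) \<longlonglongrightarrow> x"
proof -
  have "range u \<subseteq> V" "norm_bounded N (range u)"
    using assms(2,3) by (auto simp: norm_bounded_def)
  then have "compact (closure (range u))"
    using assms(1) by (simp add: compact_embedding_def)
  moreover have "\<forall>n. u n \<in> closure (range u)"
    using closure_subset[of "range u"] by auto
  ultimately obtain x r where "x \<in> closure (range u)" "strict_mono r" "(u \<circ> r) \<longlonglongrightarrow> x"
    unfolding compact_eq_seq_compact_metric by (rule seq_compactE)
  then show thesis using that by blast
qed

section \<open>Convergence of the inner products\<close>

theorem theorem4:
  fixes s0 :: "'k::real_or_complex \<Rightarrow> 'h0::banach \<Rightarrow> 'h0" and ip0 :: "'h0 \<Rightarrow> 'h0 \<Rightarrow> 'k"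
    and s1 :: "'k \<Rightarrow> 'h1::banach \<Rightarrow> 'h1" and ip1 :: "'h1 \<Rightarrow> 'h1 \<Rightarrow> 'k"
    and s2 :: "'k \<Rightarrow> 'h2::banach \<Rightarrow> 'h2" and ip2 :: "'h2 \<Rightarrow> 'h2 \<Rightarrow> 'k"
    and D0 :: "'h0 set" and A0 :: "'h0 \<Rightarrow> 'h1"
    and D1 :: "'h1 set" and A1 :: "'h1 \<Rightarrow> 'h2"
    and xs ys :: "nat \<Rightarrow> 'h1"
  assumes "hilbert_space s0 ip0" and "hilbert_space s1 ip1" and "hilbert_space s2 ip2"
    and "linear_operator s0 s1 D0 A0" and "densely_defined D0" and "closed_operator D0 A0"
    and "linear_operator s1 s2 D1 A1" and "densely_defined D1" and "closed_operator D1 A1"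
    and "range_op D0 A0 \<subseteq> kernel_op D1 A1"
    and "compact_embedding (D1 \<inter> adjoint_dom ip0 ip1 D0 A0) (graph_norm2 A1 (adjoint_op ip0 ip1 D0 A0))"
    and "range xs \<subseteq> D1" and "norm_bounded (graph_norm A1) (range xs)"
    and "range ys \<subseteq> adjoint_dom ip0 ip1 D0 A0" and "norm_bounded (graph_norm (adjoint_op ip0 ip1 D0 A0)) (range ys)"
  shows "\<exists>x\<in>D1. \<exists>y\<in>adjoint_dom ip0 ip1 D0 A0. \<exists>r :: nat \<Rightarrow> nat. strict_mono r \<and>
    weakly_converges s1 D1 (graph_norm A1) (xs \<circ> r) x \<and>
    weakly_converges s1 (adjoint_dom ip0 ip1 D0 A0) (graph_norm (adjoint_op ip0 ip1 D0 A0)) (ys \<circ> r) y \<and>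
    (\<lambda>n. ip1 ((xs \<circ> r) n) ((ys \<circ> r) n)) \<longlonglongrightarrow> ip1 x y"
proof -
  interpret h0: hilbert_space s0 ip0 by fact
  interpret h1: hilbert_space s1 ip1 by fact
  interpret h2: hilbert_space s2 ip2 by fact
  let ?D = "adjoint_dom ip0 ip1 D0 A0" and ?A = "adjoint_op ip0 ip1 D0 A0"
  note adj_eqI = adjoint_eqI[OF assms(1,2,5)] and adj = adjoint_op[OF assms(1,2,5)]
  note adj_lin = linear_operator_adjoint[OF assms(1,2,5), of A0]
  note adj_closed = closed_operator_adjoint[OF assms(1,2,5), of A0]
  have D0_sub: "h0.subspace D0"
    and A0_add: "\<And>x y. x \<in> D0 \<Longrightarrow> y \<in> D0 \<Longrightarrow> A0 (x + y) = A0 x + A0 y"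
    and A0_scale: "\<And>c x. x \<in> D0 \<Longrightarrow> A0 (s0 c x) = s1 c (A0 x)"
    using assms(4) by (auto simp: linear_operator_def linear_on_def)
  have D1_sub: "h1.subspace D1"
    and A1_add: "\<And>x y. x \<in> D1 \<Longrightarrow> y \<in> D1 \<Longrightarrow> A1 (x + y) = A1 x + A1 y"
    using assms(7) by (auto simp: linear_operator_def linear_on_def)
  have D_sub: "h1.subspace ?D"
    and A_add: "\<And>x y. x \<in> ?D \<Longrightarrow> y \<in> ?D \<Longrightarrow> ?A (x + y) = ?A x + ?A y"
    using adj_lin by (auto simp: linear_operator_def linear_on_def)

  \<comment> \<open>The closure of the range of \<open>A0\<close> and the projection onto it\<close>
  define R where "R = closure (A0 ` D0)"
  have "h1.subspace (A0 ` D0)"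
  proof (rule h1.subspaceI)
    show "0 \<in> A0 ` D0"
      using h0.subspace_0[OF D0_sub] A0_scale[of 0 0] by (intro image_eqI[where x = 0]) simp_all
    show "v + w \<in> A0 ` D0" if "v \<in> A0 ` D0" "w \<in> A0 ` D0" for v w
      using that h0.subspace_add[OF D0_sub] by (auto simp flip: A0_add)
    show "s1 c v \<in> A0 ` D0" if "v \<in> A0 ` D0" for c v
      using that h0.subspace_scale[OF D0_sub] by (auto simp flip: A0_scale)
  qed
  then have R: "h1.subspace R" "closed R"
    by (simp_all add: R_def h1.subspace_closure)
  have R_ker: "z \<in> D1" "A1 z = 0" if "z \<in> R" for z
    using closure_minimal[OF assms(10) closed_kernel_op[OF assms(9)]] that
    by (auto simp: R_def range_op_def kernel_op_def)
  \<comment> \<open>Orthogonality to the range of \<open>A0\<close> is the adjoint identity with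
    adjoint value 0.\<close>
  have ortho_ker: "q \<in> ?D" "?A q = 0" if "\<And>z. z \<in> R \<Longrightarrow> ip1 q z = 0" for q
  proof -
    have "ip1 (A0 x) q = ip0 x 0" if "x \<in> D0" for x
      using \<open>\<And>z. z \<in> R \<Longrightarrow> ip1 q z = 0\<close>[of "A0 x"] that closure_subset[of "A0 ` D0"] h1.ip_eq_0_commute
      by (auto simp: R_def)
    from adj_eqI[OF this] show "q \<in> ?D" "?A q = 0" by auto
  qed
  have "\<exists>p. p \<in> R \<and> (\<forall>z\<in>R. ip1 (x - p) z = 0)" for x
    using h1.projection_exists[OF R, of x] by metis
  then have "\<exists>P. \<forall>x. P x \<in> R \<and> (\<forall>z\<in>R. ip1 (x - P x) z = 0)"
    by (intro choice allI)
  then obtain P where P: "\<And>x. P x \<in> R" "\<And>x z. z \<in> R \<Longrightarrow> ip1 (x - P x) z = 0"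
    by blast
  have P_pyth: "(norm x)\<^sup>2 = (norm (x - P x))\<^sup>2 + (norm (P x))\<^sup>2" for x
    using h1.norm_add_sq_orthogonal[OF P(2)[OF P(1)], of x x] by simp
  have xD: "xs n \<in> D1" and yD: "ys n \<in> ?D" for n
    using assms(12,14) by blast+
  obtain B where B: "\<And>n. graph_norm A1 (xs n) \<le> B"
    using assms(13) by (auto simp: norm_bounded_def)
  obtain C where C: "\<And>n. graph_norm ?A (ys n) \<le> C"
    using assms(15) by (auto simp: norm_bounded_def)

  \<comment> \<open>Two auxiliary sequences bounded in the compactly embedded space\<close>
  define q where "q n = xs n - P (xs n)" for n
  define u where "u n = P (ys n)" for n
  have q: "q n \<in> D1 \<inter> ?D" "graph_norm2 A1 ?A (q n) \<le> B" for n
  proof -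
    have "q n \<in> D1"
      unfolding q_def by (intro h1.subspace_diff D1_sub xD R_ker P)
    moreover have qo: "q n \<in> ?D" "?A (q n) = 0"
      using ortho_ker P(2) unfolding q_def by blast+
    ultimately show "q n \<in> D1 \<inter> ?D" by blast
    have "A1 (q n) = A1 (xs n)"
      using A1_add[OF \<open>q n \<in> D1\<close> R_ker(1)[OF P(1)], of "xs n"] R_ker(2)[OF P(1)]
      by (simp add: q_def)
    \<comment> \<open>The adjoint term vanishes, the \<open>A1\<close> term is unchanged, and
      \<open>P_pyth\<close> shows that the projection step does not increase the norm.\<close>
    then have "graph_norm2 A1 ?A (q n) \<le> graph_norm A1 (xs n)"
      using qo(2) P_pyth[of "xs n"] by (simp add: graph_norm2_def graph_norm_def q_def)
    with B show "graph_norm2 A1 ?A (q n) \<le> B" using order_trans by blast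
  qed
  have u: "u n \<in> D1 \<inter> ?D" "graph_norm2 A1 ?A (u n) \<le> C" for n
  proof -
    have yo: "ys n - u n \<in> ?D" "?A (ys n - u n) = 0"
      using ortho_ker P(2) unfolding u_def by blast+
    \<comment> \<open>Write \<open>u n\<close> as \<open>ys n - (ys n - u n)\<close>; both terms lie
      in the adjoint domain.\<close>
    have uD: "u n \<in> ?D"
      using h1.subspace_diff[OF D_sub yD[of n] yo(1)] by simp
    have u1: "u n \<in> D1" "A1 (u n) = 0"
      unfolding u_def by (intro R_ker P)+
    then show "u n \<in> D1 \<inter> ?D" using uD by blast
    have "?A (u n) = ?A (ys n)"
      using A_add[OF yo(1) uD] yo(2) by simp
    then have "graph_norm2 A1 ?A (u n) \<le> graph_norm ?A (ys n)"
      using u1(2) P_pyth[of "ys n"] by (simp add: graph_norm2_def graph_norm_def u_def)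
    with C show "graph_norm2 A1 ?A (u n) \<le> C" using order_trans by blast
  qed

  \<comment> \<open>Extraction of one subsequence for two weak and two strong limits\<close>
  obtain r1 :: "nat \<Rightarrow> nat" and x where r1: "strict_mono r1"
    "weakly_converges s1 D1 (graph_norm A1) (xs \<circ> r1) x"
    using closed_operator_weak_compactness[OF assms(2,3,7,9,12,13)] .
  have "range (ys \<circ> r1) \<subseteq> ?D" "norm_bounded (graph_norm ?A) (range (ys \<circ> r1))"
    using yD C by (auto simp: norm_bounded_def)
  then obtain r2 :: "nat \<Rightarrow> nat" and y where r2: "strict_mono r2"
    "weakly_converges s1 ?D (graph_norm ?A) (ys \<circ> r1 \<circ> r2) y"
    using closed_operator_weak_compactness[OF assms(2,1) adj_lin adj_closed, of "ys \<circ> r1"] by blast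
  obtain r3 :: "nat \<Rightarrow> nat" and q' where r3: "strict_mono r3" "(q \<circ> r1 \<circ> r2 \<circ> r3) \<longlonglongrightarrow> q'"
    using compact_embedding_subsequence[OF assms(11), of "q \<circ> r1 \<circ> r2" B] q by auto
  obtain r4 :: "nat \<Rightarrow> nat" and u' where r4: "strict_mono r4" "(u \<circ> r1 \<circ> r2 \<circ> r3 \<circ> r4) \<longlonglongrightarrow> u'"
    using compact_embedding_subsequence[OF assms(11), of "u \<circ> r1 \<circ> r2 \<circ> r3" C] u by auto
  define r where "r = r1 \<circ> r2 \<circ> r3 \<circ> r4"
  have r: "strict_mono r"
    unfolding r_def by (intro strict_mono_o r1 r2 r3 r4)
  have wx: "weakly_converges s1 D1 (graph_norm A1) (xs \<circ> r) x"
    using weakly_converges_subseq[OF r1(2) strict_mono_o[OF r2(1) strict_mono_o[OF r3(1) r4(1)]]]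
    by (simp add: r_def o_assoc)
  have wy: "weakly_converges s1 ?D (graph_norm ?A) (ys \<circ> r) y"
    using weakly_converges_subseq[OF r2(2) strict_mono_o[OF r3(1) r4(1)]]
    by (simp add: r_def o_assoc)
  have lq: "(\<lambda>n. q (r n)) \<longlonglongrightarrow> q'"
    using LIMSEQ_subseq_LIMSEQ[OF r3(2) r4(1)] by (simp add: r_def o_def)
  have lu: "(\<lambda>n. u (r n)) \<longlonglongrightarrow> u'"
    using r4(2) by (simp add: r_def o_def)
  have ipx: "(\<lambda>n. ip1 (xs (r n)) w) \<longlonglongrightarrow> ip1 x w" for w
    using weakly_converges_graph_ip[OF assms(2) wx] by (simp add: o_def)
  have ipy: "(\<lambda>n. ip1 (ys (r n)) w) \<longlonglongrightarrow> ip1 y w" for w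
    using weakly_converges_graph_ip[OF assms(2) wy] by (simp add: o_def)
  have nx: "norm (xs (r n)) \<le> B" and ny: "norm (ys (r n)) \<le> C" for n
    by (rule order_trans[OF norm_le_graph_norm B], rule order_trans[OF norm_le_graph_norm C])

  \<comment> \<open>Orthogonality relations of the limits and identification of the limit\<close>
  have uR: "u' \<in> R"
    using closed_sequentially[OF R(2) _ lu] P(1) by (simp add: u_def)
  have y_ortho: "ip1 z (y - u') = 0" if "z \<in> R" for z
  proof -
    have "(\<lambda>n. ip1 (ys (r n)) z - ip1 (u (r n)) z) \<longlonglongrightarrow> ip1 y z - ip1 u' z"
      by (intro tendsto_diff ipy h1.tendsto_ip lu tendsto_const)
    moreover have "ip1 (ys (r n)) z - ip1 (u (r n)) z = 0" for n
      using P(2)[OF that, of "ys (r n)"] by (simp add: u_def h1.ip_diff_left)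
    ultimately have "ip1 (y - u') z = 0"
      by (simp add: LIMSEQ_const_iff h1.ip_diff_left)
    then show ?thesis using h1.ip_eq_0_commute by blast
  qed
  \<comment> \<open>The difference of \<open>xs\<close> and \<open>q\<close> takes values
    \<open>P (xs (r n))\<close> in \<open>R\<close>, so each product with \<open>y - u'\<close> is
    zero by \<open>y_ortho\<close>; the relation passes to the limit.\<close>
  have x_ortho: "ip1 (x - q') (y - u') = 0"
  proof -
    have "(\<lambda>n. ip1 (xs (r n)) (y - u') - ip1 (q (r n)) (y - u')) \<longlonglongrightarrow> ip1 x (y - u') - ip1 q' (y - u')"
      by (intro tendsto_diff ipx h1.tendsto_ip lq tendsto_const)
    moreover have "ip1 (xs (r n)) (y - u') - ip1 (q (r n)) (y - u') = 0" for n
      using y_ortho[OF P(1)[of "xs (r n)"]] by (simp add: q_def h1.ip_diff_left)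
    ultimately show ?thesis
      by (simp add: LIMSEQ_const_iff h1.ip_diff_left)
  qed
  have q_ortho: "ip1 q' u' = 0"
  proof -
    have "(\<lambda>n. ip1 (q (r n)) u') \<longlonglongrightarrow> ip1 q' u'"
      by (intro h1.tendsto_ip lq tendsto_const)
    then show ?thesis
      using P(2)[OF uR] by (simp add: LIMSEQ_const_iff q_def)
  qed
  \<comment> \<open>The cross terms vanish since \<open>ys m - u m\<close> and \<open>q m\<close>
    are orthogonal to \<open>R\<close>. The second product is conjugated so that its weakly
    convergent factor comes first.\<close>
  have split: "ip1 (xs m) (ys m) = ip1 (xs m) (u m) + conjugate (ip1 (ys m) (q m))" for m
  proof -
    have "ip1 (P (xs m)) (ys m - u m) = 0"
      using P(2)[OF P(1), of "ys m" "xs m"] h1.ip_eq_0_commute unfolding u_def by blast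
    moreover have "ip1 (q m) (u m) = 0"
      using P(2)[OF P(1)] by (simp add: q_def u_def)
    ultimately show ?thesis
      unfolding h1.ip_conjugate[symmetric] by (simp add: q_def h1.ip_diff_left h1.ip_diff_right)
  qed
  have "(\<lambda>n. ip1 (xs (r n)) (ys (r n))) \<longlonglongrightarrow> ip1 x u' + conjugate (ip1 y q')"
    unfolding split
    by (intro tendsto_add bounded_linear.tendsto[OF bounded_linear_conjugate]
      tendsto_ip_weak_strong[OF assms(2) nx ipx lu] tendsto_ip_weak_strong[OF assms(2) ny ipy lq])
  \<comment> \<open>Expanding \<open>x_ortho\<close> and dropping \<open>ip1 q' u' = 0\<close>
    leaves exactly this identity.\<close>
  also have "ip1 x u' + conjugate (ip1 y q') = ip1 x y"
    unfolding h1.ip_conjugate[symmetric]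
    using x_ortho q_ortho by (simp add: h1.ip_diff_left h1.ip_diff_right diff_eq_eq)
  finally have "(\<lambda>n. ip1 ((xs \<circ> r) n) ((ys \<circ> r) n)) \<longlonglongrightarrow> ip1 x y" by (simp add: o_def)
  then show ?thesis
    using r wx wy by (auto simp: weakly_converges_def)
qed

end
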